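(* The $B$-term $B^2=B\circ B$ (i.e. $B\,B\,B$) does not have the $\rho$-property: there are no two distinct positive integers $i\neq j$ such that $(B^2)_{(i)}$ and $(B^2)_{(j)}$ are $\beta\eta$-equivalent.
   Context: $B=\lambda f.\lambda g.\lambda x.\, f\,(g\,x)$ and $e_1\circ e_2$ denotes $B\,e_1\,e_2$. For a term $X$ and $k\ge1$, $X_{(k)}$ denotes $X\,X\cdots X$ ($k$ copies, application associated to the left). A term $X$ has the $\rho$-property if there are distinct positive integers $i,j$ with $X_{(i)}=X_{(j)}$ up to $\beta\eta$-equivalence. *)

theory Defs
  imports Main
begin

text \<open>Untyped \<open>\<lambda>\<close>-terms up to \<open>\<alpha>\<close>-equivalence, with de Bruijn indices starting at 0.\<close>

datatype lterm =
    Var nat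
  | App lterm lterm  (infixl \<open>\<cdot>\<close> 200)
  | Lam lterm

text \<open>\<open>lift t k\<close> increments the indices \<open>\<ge> k\<close> of \<open>t\<close>, that is, it makes room for one fresh
  variable with index \<open>k\<close>.\<close>

primrec lift :: "lterm \<Rightarrow> nat \<Rightarrow> lterm" where
  "lift (Var i) k = (if i < k then Var i else Var (Suc i))"
| "lift (s \<cdot> t) k = lift s k \<cdot> lift t k"
| "lift (Lam t) k = Lam (lift t (Suc k))"

text \<open>\<open>subst t k s\<close> replaces the index \<open>k\<close> in \<open>t\<close> by \<open>s\<close> and, since the binder of \<open>k\<close> disappears
  in a \<open>\<beta>\<close>-step, decrements the indices \<open>> k\<close>.\<close>

primrec subst :: "lterm \<Rightarrow> nat \<Rightarrow> lterm \<Rightarrow> lterm" where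
  "subst (Var i) k s = (if i < k then Var i else if i = k then s else Var (i - 1))"
| "subst (t \<cdot> u) k s = subst t k s \<cdot> subst u k s"
| "subst (Lam t) k s = Lam (subst t (Suc k) (lift s 0))"

text \<open>The side condition of \<open>\<eta>\<close> (the abstracted variable is not free in the function part) is
  expressed by the function part being of the form \<open>lift t 0\<close>.\<close>

inductive beta_eta :: "lterm \<Rightarrow> lterm \<Rightarrow> bool"  (infix \<open>\<rightarrow>\<^sub>\<beta>\<^sub>\<eta>\<close> 50) where
  beta: "Lam t \<cdot> s \<rightarrow>\<^sub>\<beta>\<^sub>\<eta> subst t 0 s"
| eta: "Lam (lift t 0 \<cdot> Var 0) \<rightarrow>\<^sub>\<beta>\<^sub>\<eta> t"
| appL: "s \<rightarrow>\<^sub>\<beta>\<^sub>\<eta> s' \<Longrightarrow> s \<cdot> t \<rightarrow>\<^sub>\<beta>\<^sub>\<eta> s' \<cdot> t"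
| appR: "t \<rightarrow>\<^sub>\<beta>\<^sub>\<eta> t' \<Longrightarrow> s \<cdot> t \<rightarrow>\<^sub>\<beta>\<^sub>\<eta> s \<cdot> t'"
| lam: "t \<rightarrow>\<^sub>\<beta>\<^sub>\<eta> t' \<Longrightarrow> Lam t \<rightarrow>\<^sub>\<beta>\<^sub>\<eta> Lam t'"

abbreviation beta_eta_equiv :: "lterm \<Rightarrow> lterm \<Rightarrow> bool"  (infix \<open>=\<^sub>\<beta>\<^sub>\<eta>\<close> 50) where
  "s =\<^sub>\<beta>\<^sub>\<eta> t \<equiv> equivclp beta_eta s t"

text \<open>\<open>\<lambda>f. \<lambda>g. \<lambda>x. f (g x)\<close>: under the three binders, \<open>f\<close>, \<open>g\<close>, \<open>x\<close> have the indices 2, 1, 0.\<close>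

definition B_comb :: lterm where
  "B_comb = Lam (Lam (Lam (Var 2 \<cdot> (Var 1 \<cdot> Var 0))))"

definition B_compose :: "lterm \<Rightarrow> lterm \<Rightarrow> lterm"  (infixl \<open>\<circ>\<^sub>B\<close> 190) where
  "e1 \<circ>\<^sub>B e2 = B_comb \<cdot> e1 \<cdot> e2"

text \<open>\<open>X\<^bsub>(k)\<^esub> = X \<cdot> X \<cdot> \<dots> \<cdot> X\<close> with \<open>k\<close> copies of \<open>X\<close>; only meaningful for \<open>k \<ge> 1\<close>.\<close>

definition self_app :: "lterm \<Rightarrow> nat \<Rightarrow> lterm" where
  "self_app X k = ((\<lambda>Y. Y \<cdot> X) ^^ (k - 1)) X"

definition rho_property :: "lterm \<Rightarrow> bool" where
  "rho_property X \<longleftrightarrow> (\<exists>i j. 0 < i \<and> 0 < j \<and> i \<noteq> j \<and> self_app X i =\<^sub>\<beta>\<^sub>\<eta> self_app X j)"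

end

theory Submission
  imports Defs "HOL-Library.Nat_Bijection"
begin

text \<open>Let \<open>C\<^sub>0\<close> be a single leaf and \<open>C\<^sub>n\<^sub>+\<^sub>1\<close> the tree \<open>x C\<^sub>n y\<close>, with pairwise distinct variables in
  the leaves from left to right. Each \<open>X\<^bsub>(k)\<^esub>\<close> with \<open>X = B\<^sup>2\<close> acts on sufficiently many arguments as
  \<open>f xs z ys \<mapsto> f C\<^sub>i(xs) z C\<^sub>j(ys)\<close> for some pair \<open>(i, j)\<close>. Since \<open>B\<^sup>2 f g x y = f (g x y)\<close>, a further
  application to \<open>X\<close> turns \<open>(i + 1, j)\<close> into \<open>(i, j + 1)\<close> and \<open>(0, n)\<close> into \<open>(n + 1, 0)\<close>, so the pairs
  run through Cantor's enumeration and never repeat. Different pairs are told apart in an extensional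
  filter model of the \<open>\<lambda>\<close>-calculus, which replaces a proof of confluence of \<open>\<beta>\<eta>\<close>.\<close>

section \<open>An extensional filter model\<close>

text \<open>Intersection types: \<open>Arrow a p\<close> is the arrow from \<open>a\<close> to
  \<open>p\<close>, where the list \<open>a\<close> stands for the intersection of its members and
  \<open>[]\<close> for the universal type. \<open>leq\<close> is subtyping.\<close>

datatype point = Star | Arrow "point list" point

function leq :: "point \<Rightarrow> point \<Rightarrow> bool" where
  "leq Star q = True"
| "leq (Arrow a p) Star = (a = [] \<and> leq p Star)"
| "leq (Arrow a p) (Arrow b q) = (leq p q \<and> (\<forall>x\<in>set a. \<exists>y\<in>set b. leq y x))"
  by pat_completeness auto
termination
proof (relation "measure (\<lambda>(p, q). size p + size q)"; simp)
  fix a b :: "point list" and p q x y :: point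
  assume "x \<in> set a" "y \<in> set b"
  then have "size x \<le> size_list size a" "size y \<le> size_list size b"
    by (simp_all add: size_list_estimation')
  then show "size y + size x < Suc (Suc (size_list size a + size p + (size_list size b + size q)))"
    by simp
qed

lemma size_point_mem: "x \<in> set a \<Longrightarrow> size x \<le> size_list size a" for x :: point
  by (simp add: size_list_estimation')

lemma leq_refl: "leq p p"
proof (induction p)
  case (Arrow a p)
  then show ?case by auto
qed simp

lemma leq_trans: "leq p q \<Longrightarrow> leq q r \<Longrightarrow> leq p r"
\<comment> \<open>Contravariance reverses the triple on the left of arrows, so structural induction
  does not suffice.\<close>
proof (induction "size p + size q + size r" arbitrary: p q r rule: less_induct)
  case less
  show ?case
  proof (cases p)
    case (Arrow a p')
    note p = this
    show ?thesis
    proof (cases q)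
      case Star
      then show ?thesis
        using p less.prems less.hyps[of "p'" Star "case r of Arrow c r' \<Rightarrow> r'"] by (cases r) auto
    next
      case (Arrow b q')
      note q = this
      show ?thesis
      proof (cases r)
        case Star
        then show ?thesis using p q less.prems less.hyps[of p' q' Star] by auto
      next
        case (Arrow c r')
        note r = this
        have "\<exists>z\<in>set c. leq z x" if x: "x \<in> set a" for x
        proof -
          obtain y where y: "y \<in> set b" "leq y x" using less.prems p q x by auto
          then obtain z where z: "z \<in> set c" "leq z y" using less.prems q r by auto
          have "size z + size y + size x < size p + size q + size r"
            using size_point_mem[OF x] size_point_mem[OF y(1)] size_point_mem[OF z(1)] p q r
            by simp
          then show ?thesis using less.hyps z y by blast
        qed
        then show ?thesis using p q r less.prems less.hyps[of p' q' r'] by auto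
      qed
    qed
  qed simp
qed

text \<open>Intersections occur only to the left of arrows, so a filter is just an upward closed
  set.\<close>

definition filt :: "point set \<Rightarrow> bool" where
  "filt X \<longleftrightarrow> (\<forall>p q. p \<in> X \<longrightarrow> leq p q \<longrightarrow> q \<in> X)"

definition up :: "point list \<Rightarrow> point set" where
  "up a = {q. \<exists>p\<in>set a. leq p q}"

definition ap :: "point set \<Rightarrow> point set \<Rightarrow> point set" where
  "ap f X = {p. \<exists>a. Arrow a p \<in> f \<and> set a \<subseteq> X}"

text \<open>The case \<open>Star\<close> is forced by the identification of \<open>Star\<close> with \<open>Arrow [] Star\<close>, which
  makes the model extensional.\<close>

definition abst :: "(point set \<Rightarrow> point set) \<Rightarrow> point set" where
  "abst F = {p. case p of Star \<Rightarrow> Star \<in> F {} | Arrow a q \<Rightarrow> q \<in> F (up a)}"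

primrec eval :: "lterm \<Rightarrow> (nat \<Rightarrow> point set) \<Rightarrow> point set" where
  "eval (Var i) \<rho> = \<rho> i"
| "eval (s \<cdot> t) \<rho> = ap (eval s \<rho>) (eval t \<rho>)"
| "eval (Lam t) \<rho> = abst (\<lambda>X. eval t (case_nat X \<rho>))"

lemma abst_iff [simp]:
  "Star \<in> abst F \<longleftrightarrow> Star \<in> F {}" "Arrow a p \<in> abst F \<longleftrightarrow> p \<in> F (up a)"
  by (simp_all add: abst_def)

lemma up_Nil [simp]: "up [] = {}"
  by (simp add: up_def)

lemma filt_up [simp]: "filt (up a)"
  using leq_trans by (auto simp: filt_def up_def)

lemma filt_empty [simp]: "filt {}" and filt_UNIV [simp]: "filt UNIV"
  by (simp_all add: filt_def)

text \<open>\<open>abst\<close> inspects its function only at \<open>{}\<close> and at sets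
  \<open>up a\<close>, all of them filters.\<close>

lemma abst_cong:
  assumes "\<And>X. filt X \<Longrightarrow> F X = G X"
  shows "abst F = abst G"
  using assms by (auto simp: abst_def split: point.split)

lemma filtD: "filt X \<Longrightarrow> p \<in> X \<Longrightarrow> leq p q \<Longrightarrow> q \<in> X"
  by (auto simp: filt_def)

lemma up_least: "filt X \<Longrightarrow> set a \<subseteq> X \<Longrightarrow> up a \<subseteq> X"
  by (auto simp: filt_def up_def)

lemma subset_up: "set a \<subseteq> up a"
  using leq_refl by (auto simp: up_def)

lemma up_mono: "set a \<subseteq> set b \<Longrightarrow> up a \<subseteq> up b"
  by (auto simp: up_def)

lemma ap_mono: "f \<subseteq> g \<Longrightarrow> X \<subseteq> Y \<Longrightarrow> ap f X \<subseteq> ap g Y"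
  by (fastforce simp: ap_def)

lemma filt_ap [simp]:
  assumes "filt f"
  shows "filt (ap f X)"
  unfolding filt_def
proof (intro allI impI)
  fix p q
  assume "p \<in> ap f X" and pq: "leq p q"
  then obtain a where a: "Arrow a p \<in> f" "set a \<subseteq> X" by (auto simp: ap_def)
  have "leq (Arrow a p) (Arrow a q)" using pq leq_refl by auto
  then have "Arrow a q \<in> f" using assms a(1) by (rule filtD[rotated 2])
  then show "q \<in> ap f X" using a(2) by (auto simp: ap_def)
qed

lemma filt_abst:
  assumes filt: "\<And>X. filt X \<Longrightarrow> filt (F X)" and mono: "\<And>X Y. X \<subseteq> Y \<Longrightarrow> F X \<subseteq> F Y"
  shows "filt (abst F)"
  unfolding filt_def
proof (intro allI impI)
  fix p q
  assume p: "p \<in> abst F" and pq: "leq p q"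
  have F: "x \<in> F Y" if "y \<in> F X" "filt X" "leq y x" "X \<subseteq> Y" for x y X Y
    using that filtD[OF filt[of X]] mono[of X Y] by blast
  show "q \<in> abst F"
  proof (cases p)
    case Star
    then show ?thesis using p F[of Star "{}"] by (cases q) auto
  next
    case (Arrow a p')
    note pa = this
    show ?thesis
    proof (cases q)
      case Star
      then show ?thesis using p pa pq F[of p' "{}"] by auto
    next
      case (Arrow b q')
      have "up a \<subseteq> up b"
      proof (rule up_least)
        show "set a \<subseteq> up b" using pq pa Arrow by (auto simp: up_def)
      qed simp
      then show ?thesis using p pa pq Arrow F[of p' "up a"] by auto
    qed
  qed
qed

section \<open>Monotonicity and continuity of the interpretation\<close>

lemma eval_mono: "(\<And>i. \<rho> i \<subseteq> \<sigma> i) \<Longrightarrow> eval t \<rho> \<subseteq> eval t \<sigma>"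
proof (induction t arbitrary: \<rho> \<sigma>)
  case (Lam t)
  have "eval t (case_nat X \<rho>) \<subseteq> eval t (case_nat X \<sigma>)" for X
    by (rule Lam.IH) (auto simp: Lam.prems split: nat.split)
  then show ?case by (auto simp: abst_def split: point.split)
next
  case (App s t)
  then show ?case by (simp add: ap_mono)
qed simp

lemma filt_eval: "(\<And>i. filt (\<rho> i)) \<Longrightarrow> filt (eval t \<rho>)"
proof (induction t arbitrary: \<rho>)
  case (Lam t)
  show ?case unfolding eval.simps
  proof (rule filt_abst)
    show "filt (eval t (case_nat X \<rho>))" if "filt X" for X
      by (rule Lam.IH) (auto simp: that Lam.prems split: nat.split)
    show "eval t (case_nat X \<rho>) \<subseteq> eval t (case_nat Y \<rho>)" if "X \<subseteq> Y" for X Y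
      by (rule eval_mono) (use that in \<open>auto split: nat.split\<close>)
  qed
qed simp_all

text \<open>Each point of a value depends on finitely many points of each variable. This provides
  the finite list to the left of an arrow in \<open>ap_eval_Lam\<close>.\<close>

lemma eval_continuous:
  "p \<in> eval t \<rho> \<Longrightarrow> \<exists>A. (\<forall>i. set (A i) \<subseteq> \<rho> i) \<and> p \<in> eval t (\<lambda>i. up (A i))"
proof (induction t arbitrary: \<rho> p)
  case (Var i)
  then show ?case
    using leq_refl by (intro exI[of _ "\<lambda>j. if j = i then [p] else []"]) (auto simp: up_def)
next
  case (App s t)
  let ?e = "\<lambda>A. (\<lambda>i. up (A i))"
  obtain a where a: "Arrow a p \<in> eval s \<rho>" "set a \<subseteq> eval t \<rho>"
    using App.prems by (auto simp: ap_def)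
  have join: "eval u (?e A) \<union> eval u (?e B) \<subseteq> eval u (?e (\<lambda>i. A i @ B i))" for A B u
    by (intro Un_least eval_mono up_mono) auto
  have "\<exists>A. (\<forall>i. set (A i) \<subseteq> \<rho> i) \<and> set a \<subseteq> eval t (?e A)"
    using a(2)
  proof (induction a)
    case Nil
    show ?case by (rule exI[of _ "\<lambda>i. []"]) simp
  next
    case (Cons x a)
    then obtain A where A: "\<forall>i. set (A i) \<subseteq> \<rho> i" "set a \<subseteq> eval t (?e A)" by auto
    obtain B where B: "\<forall>i. set (B i) \<subseteq> \<rho> i" "x \<in> eval t (?e B)"
      using App.IH(2)[of x \<rho>] Cons.prems by auto
    show ?case
      using A B join[of t A B] by (intro exI[of _ "\<lambda>i. A i @ B i"]) auto
  qed
  then obtain A where A: "\<forall>i. set (A i) \<subseteq> \<rho> i" "set a \<subseteq> eval t (?e A)" by auto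
  obtain B where B: "\<forall>i. set (B i) \<subseteq> \<rho> i" "Arrow a p \<in> eval s (?e B)"
    using App.IH(1)[OF a(1)] by auto
  have "p \<in> eval (s \<cdot> t) (?e (\<lambda>i. A i @ B i))"
    unfolding eval.simps ap_def using A(2) B(2) join[of t A B] join[of s A B] by blast
  then show ?case
    using A B by (intro exI[of _ "\<lambda>i. A i @ B i"]) auto
next
  case (Lam t)
  \<comment> \<open>Only the free variables are approximated; the bound one gets its full value
    \<open>X\<close> back by monotonicity.\<close>
  have tail: "\<exists>A. (\<forall>i. set (A i) \<subseteq> \<rho> i) \<and> q \<in> eval t (case_nat X (\<lambda>i. up (A i)))"
    if q: "q \<in> eval t (case_nat X \<rho>)" and X: "filt X" for q X
  proof -
    obtain A where A: "\<forall>i. set (A i) \<subseteq> case_nat X \<rho> i" "q \<in> eval t (\<lambda>i. up (A i))"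
      using Lam.IH[OF q] by auto
    have "up (A 0) \<subseteq> X" using A(1)[rule_format, of 0] X by (simp add: up_least)
    then have "eval t (\<lambda>i. up (A i)) \<subseteq> eval t (case_nat X (\<lambda>i. up (A (Suc i))))"
      by (intro eval_mono) (auto split: nat.split)
    moreover have "set (A (Suc i)) \<subseteq> \<rho> i" for i
      using A(1)[rule_format, of "Suc i"] by simp
    ultimately show ?thesis
      using A(2) by (intro exI[of _ "\<lambda>i. A (Suc i)"]) auto
  qed
  show ?case
  proof (cases p)
    case Star
    then show ?thesis using Lam.prems tail[of Star "{}"] by auto
  next
    case (Arrow a q)
    then show ?thesis using Lam.prems tail[of q "up a"] by auto
  qed
qed

text \<open>The \<beta>-law: one inclusion is monotonicity, the other continuity, with the
  approximation \<open>A 0\<close> of \<open>X\<close> as the arrow's argument list.\<close>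

lemma ap_eval_Lam:
  assumes X: "filt X" and \<rho>: "\<And>i. filt (\<rho> i)"
  shows "ap (eval (Lam t) \<rho>) X = eval t (case_nat X \<rho>)"
proof (rule Set.equalityI; rule subsetI)
  fix p
  assume "p \<in> ap (eval (Lam t) \<rho>) X"
  then obtain a where a: "p \<in> eval t (case_nat (up a) \<rho>)" "set a \<subseteq> X"
    by (auto simp: ap_def)
  have "eval t (case_nat (up a) \<rho>) \<subseteq> eval t (case_nat X \<rho>)"
    by (rule eval_mono) (use up_least[OF X a(2)] in \<open>auto split: nat.split\<close>)
  then show "p \<in> eval t (case_nat X \<rho>)" using a(1) by blast
next
  fix p
  assume "p \<in> eval t (case_nat X \<rho>)"
  then obtain A where A: "\<forall>i. set (A i) \<subseteq> case_nat X \<rho> i" "p \<in> eval t (\<lambda>i. up (A i))"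
    using eval_continuous by blast
  have "set (A 0) \<subseteq> X" using A(1)[rule_format, of 0] by simp
  moreover have "up (A i) \<subseteq> case_nat (up (A 0)) \<rho> i" for i
    using A(1)[rule_format, of i] up_least[OF \<rho>] by (cases i) simp_all
  then have "p \<in> eval t (case_nat (up (A 0)) \<rho>)"
    using A(2) eval_mono[of "\<lambda>i. up (A i)"] by blast
  ultimately show "p \<in> ap (eval (Lam t) \<rho>) X"
    by (auto simp: ap_def)
qed

section \<open>Soundness for \<beta>\<eta>-equivalence\<close>

lemma eval_lift:
  "eval (lift t k) \<rho> = eval t (\<lambda>i. if i < k then \<rho> i else \<rho> (Suc i))"
proof (induction t arbitrary: k \<rho>)
  case (Lam t)
  have "(\<lambda>i. if i < Suc k then case_nat X \<rho> i else case_nat X \<rho> (Suc i))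
      = case_nat X (\<lambda>i. if i < k then \<rho> i else \<rho> (Suc i))" for X
    by (rule ext, rename_tac i, case_tac i) auto
  then show ?case by (simp add: Lam.IH)
qed simp_all

lemma eval_subst:
  "eval (subst t k s) \<rho> =
    eval t (\<lambda>i. if i < k then \<rho> i else if i = k then eval s \<rho> else \<rho> (i - 1))"
proof (induction t arbitrary: k s \<rho>)
  case (Lam t)
  have "(\<lambda>i. if i < Suc k then case_nat X \<rho> i else if i = Suc k then eval s \<rho>
        else case_nat X \<rho> (i - 1))
      = case_nat X (\<lambda>i. if i < k then \<rho> i else if i = k then eval s \<rho> else \<rho> (i - 1))" for X
    by (rule ext, rename_tac i, case_tac i) (auto split: nat.split)
  then show ?case by (simp add: Lam.IH eval_lift cong: if_cong)
qed simp_all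

text \<open>The \<eta>-law: \<open>Arrow\<close> points are handled by contravariance,
  \<open>Star\<close> by its equivalence with \<open>Arrow [] Star\<close>.\<close>

lemma abst_ap:
  assumes f: "filt f"
  shows "abst (ap f) = f"
proof (rule set_eqI)
  fix p
  show "p \<in> abst (ap f) \<longleftrightarrow> p \<in> f"
  proof (cases p)
    case Star
    have "Star \<in> f \<longleftrightarrow> Arrow [] Star \<in> f"
      using filtD[OF f, of Star "Arrow [] Star"] filtD[OF f, of "Arrow [] Star" Star] by auto
    then show ?thesis using Star by (simp add: ap_def)
  next
    case (Arrow a q)
    have "Arrow a q \<in> f" if "Arrow b q \<in> f" "set b \<subseteq> up a" for b
      using that leq_refl by (intro filtD[OF f that(1)]) (auto simp: up_def)
    moreover have "set a \<subseteq> up a" by (rule subset_up)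
    ultimately have "(\<exists>b. Arrow b q \<in> f \<and> set b \<subseteq> up a) \<longleftrightarrow> Arrow a q \<in> f" by blast
    then show ?thesis using Arrow by (simp add: ap_def)
  qed
qed

lemma eval_beta_eta:
  "s \<rightarrow>\<^sub>\<beta>\<^sub>\<eta> t \<Longrightarrow> (\<And>i. filt (\<rho> i)) \<Longrightarrow> eval s \<rho> = eval t \<rho>"
proof (induction arbitrary: \<rho> rule: beta_eta.induct)
  case (beta t s)
  have "case_nat X \<rho> = (\<lambda>i. if i = 0 then X else \<rho> (i - 1))" for X
    by (rule ext) (auto split: nat.split)
  then show ?case
    using ap_eval_Lam[OF filt_eval[of \<rho> s], of \<rho> t] beta by (simp add: eval_subst)
next
  case (eta t)
  then show ?case by (simp add: eval_lift abst_ap filt_eval)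
next
  case (lam t t')
  show ?case unfolding eval.simps
    by (rule abst_cong, rule lam.IH) (auto simp: lam.prems split: nat.split)
qed simp_all

lemma eval_beta_eta_equiv:
  assumes "s =\<^sub>\<beta>\<^sub>\<eta> t" "\<And>i. filt (\<rho> i)"
  shows "eval s \<rho> = eval t \<rho>"
  using assms(1)
proof (induction rule: equivclp_induct)
  case (step y z)
  then show ?case using eval_beta_eta[of y z] eval_beta_eta[of z y] assms(2) by metis
qed simp

section \<open>The orbit of \<open>B\<^sup>2\<close>\<close>

abbreviation den :: "lterm \<Rightarrow> point set" where
  "den t \<equiv> eval t (\<lambda>_. {})"

abbreviation B2 :: lterm where
  "B2 \<equiv> B_comb \<circ>\<^sub>B B_comb"

lemma filt_den [simp]: "filt (den t)"
  by (simp add: filt_eval)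

lemma ap_B_comb:
  assumes "filt f" "filt g" "filt x"
  shows "ap (ap (ap (den B_comb) f) g) x = ap f (ap g x)"
proof -
  have "filt (case_nat f (\<lambda>_. {}) i)" "filt (case_nat g (case_nat f (\<lambda>_. {})) i)" for i
    using assms by (auto split: nat.split)
  then show ?thesis
    using assms by (simp add: B_comb_def ap_eval_Lam del: eval.simps(3))
qed

lemma ap_B2:
  assumes "filt f" "filt g" "filt x" "filt y"
  shows "ap (ap (ap (ap (den B2) f) g) x) y = ap f (ap (ap g x) y)"
  using assms by (simp add: B_compose_def ap_B_comb)

text \<open>\<open>nest n\<close> is the tree \<open>x\<^sub>1 (x\<^sub>2 (\<dots> (x\<^sub>n x\<^sub>n\<^sub>+\<^sub>1 x\<^sub>n\<^sub>+\<^sub>2) \<dots>) x\<^sub>2\<^sub>n) x\<^sub>2\<^sub>n\<^sub>+\<^sub>1\<close> over its \<open>2n + 1\<close> leaves.\<close>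

primrec nest :: "nat \<Rightarrow> point set list \<Rightarrow> point set" where
  "nest 0 xs = hd xs"
| "nest (Suc n) xs = ap (ap (hd xs) (nest n (butlast (tl xs)))) (last xs)"

definition acts_as :: "point set \<Rightarrow> nat \<Rightarrow> nat \<Rightarrow> bool" where
  "acts_as d i j \<longleftrightarrow> (\<forall>f xs z ys. filt f \<longrightarrow> filt z \<longrightarrow> list_all filt xs \<longrightarrow> list_all filt ys \<longrightarrow>
    length xs = 2 * i + 1 \<longrightarrow> length ys = 2 * j + 1 \<longrightarrow>
    foldl ap d (f # xs @ z # ys) = ap (ap (ap f (nest i xs)) z) (nest j ys))"

lemma acts_asD:
  assumes "acts_as d i j" "filt f" "filt z" "list_all filt xs" "list_all filt ys"
    "length xs = 2 * i + 1" "length ys = 2 * j + 1"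
  shows "foldl ap d (f # xs @ z # ys) = ap (ap (ap f (nest i xs)) z) (nest j ys)"
  using assms by (simp add: acts_as_def)

lemma filt_nest:
  "list_all filt xs \<Longrightarrow> length xs = 2 * n + 1 \<Longrightarrow> filt (nest n xs)"
  by (cases xs; cases n) simp_all

lemma length_ge_2E:
  assumes "length xs = Suc (Suc n)"
  obtains x ys y where "xs = x # ys @ [y]" "length ys = n"
proof -
  obtain x zs where "xs = x # zs" "length zs = Suc n"
    using assms by (auto simp: length_Suc_conv)
  moreover from this obtain ys y where "zs = ys @ [y]" "length ys = n"
    by (metis length_Suc_conv_rev)
  ultimately show thesis using that by blast
qed

lemma acts_as_step:
  assumes d: "acts_as d (Suc i) j"
  shows "acts_as (ap d (den B2)) i (Suc j)"
  unfolding acts_as_def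
proof (intro allI impI)
  fix f xs z ys
  assume h: "filt f" "filt z" "list_all filt xs" "list_all filt ys"
    "length xs = 2 * i + 1" "length ys = 2 * Suc j + 1"
  have "length ys = Suc (Suc (2 * j + 1))" using h(6) by simp
  then obtain x zs y where ys: "ys = x # zs @ [y]" "length zs = 2 * j + 1"
    by (rule length_ge_2E)
  \<comment> \<open>\<open>B2\<close> becomes the head, \<open>f\<close> and \<open>z\<close> the
    outer leaves of the first tree, and \<open>x\<close> the middle argument; \<open>y\<close> is
    left over and supplies the last argument for \<open>ap_B2\<close>.\<close>
  have "foldl ap (ap d (den B2)) (f # xs @ z # ys)
      = ap (foldl ap d (den B2 # (f # xs @ [z]) @ x # zs)) y"
    by (simp add: ys)
  also have "\<dots> = ap (ap (ap (ap (den B2) (nest (Suc i) (f # xs @ [z]))) x) (nest j zs)) y"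
    by (subst acts_asD[OF d]) (use h ys in auto)
  also have "\<dots> = ap (nest (Suc i) (f # xs @ [z])) (nest (Suc j) ys)"
    using h ys by (subst ap_B2) (auto simp: filt_nest)
  finally show "foldl ap (ap d (den B2)) (f # xs @ z # ys)
      = ap (ap (ap f (nest i xs)) z) (nest (Suc j) ys)"
    by simp
qed

lemma acts_as_turn:
  assumes d: "acts_as d 0 n"
  shows "acts_as (ap d (den B2)) (Suc n) 0"
  unfolding acts_as_def
proof (intro allI impI)
  fix f xs z ys
  assume h: "filt f" "filt z" "list_all filt xs" "list_all filt ys"
    "length xs = 2 * Suc n + 1" "length ys = 2 * 0 + 1"
  have "length xs = Suc (Suc (2 * n + 1))" using h(5) by simp
  then obtain x zs y where xs: "xs = x # zs @ [y]" "length zs = 2 * n + 1"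
    by (rule length_ge_2E)
  obtain w where w: "ys = [w]" using h(6) by (auto simp: length_Suc_conv)
  \<comment> \<open>The first tree is now the single leaf \<open>f\<close>, and \<open>zs\<close>
    fills the second; \<open>y\<close> completes the arguments of \<open>B2\<close>, leaving
    \<open>z\<close> and \<open>w\<close> outside.\<close>
  have "foldl ap (ap d (den B2)) (f # xs @ z # ys)
      = ap (ap (ap (foldl ap d (den B2 # [f] @ x # zs)) y) z) w"
    by (simp add: xs w)
  also have "\<dots> = ap (ap (ap (ap (ap (ap (den B2) f) x) (nest n zs)) y) z) w"
    by (subst acts_asD[OF d]) (use h xs in auto)
  also have "\<dots> = ap (ap (ap f (nest (Suc n) xs)) z) w"
    using h xs by (subst ap_B2) (auto simp: filt_nest)
  finally show "foldl ap (ap d (den B2)) (f # xs @ z # ys)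
      = ap (ap (ap f (nest (Suc n) xs)) z) (nest 0 ys)"
    by (simp add: w)
qed

text \<open>For three leaves a, b, c, \<open>nest 1\<close> is a b c, so this is
  \<open>ap_B2\<close> followed by two more arguments.\<close>

lemma acts_as_B2: "acts_as (den B2) 1 0"
  by (auto simp: acts_as_def length_Suc_conv ap_B2 numeral_eq_Suc)

lemma self_app_1: "self_app X (Suc 0) = X"
  by (simp add: self_app_def)

lemma self_app_Suc: "k \<ge> 1 \<Longrightarrow> self_app X (Suc k) = self_app X k \<cdot> X"
  by (cases k) (simp_all add: self_app_def)

text \<open>\<open>prod_encode (j, i)\<close> is \<open>triangle (j + i) + j\<close>, so in this
  order of coordinates adding 1 to the code is exactly the transition of pairs. The orbit starts at
  code 1, the pair i = 1, j = 0.\<close>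

lemma acts_as_self_app:
  "k \<ge> 1 \<Longrightarrow> k = prod_encode (j, i) \<Longrightarrow> acts_as (den (self_app B2 k)) i j"
proof (induction k arbitrary: i j rule: nat_induct_at_least)
  case base
  have "prod_encode (0, 1) = 1" by (simp add: prod_encode_def)
  then have "(j, i) = (0, 1)" using base inj_prod_encode[of UNIV] by (metis injD)
  then show ?case using acts_as_B2 by (simp add: self_app_1)
next
  case (Suc k)
  note app = self_app_Suc[OF Suc.hyps]
  show ?case
  proof (cases j)
    case (Suc j')
    then have "k = prod_encode (j', Suc i)"
      using \<open>Suc k = prod_encode (j, i)\<close> by (simp add: prod_encode_def)
    then show ?thesis using Suc.IH acts_as_step \<open>j = Suc j'\<close> app by simp
  next
    \<comment> \<open>The pair starts an antidiagonal; its predecessor ends the previous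
      one.\<close>
    case 0
    then obtain i' where "i = Suc i'"
      using \<open>Suc k = prod_encode (j, i)\<close> by (cases i) (auto simp: prod_encode_def)
    moreover from this 0 have "k = prod_encode (i', 0)"
      using \<open>Suc k = prod_encode (j, i)\<close> by (simp add: prod_encode_def)
    ultimately show ?thesis using Suc.IH acts_as_turn 0 app by simp
  qed
qed

section \<open>Separating pairs by a test element\<close>

text \<open>A filter contains the least point \<open>Star\<close> only if it is the top element \<open>UNIV\<close>, so \<open>test\<close>
  maps the top element to itself and all other elements to bottom.\<close>

definition test :: "point set" where
  "test = abst (\<lambda>X. if Star \<in> X then UNIV else {})"

lemma ap_UNIV [simp]: "ap UNIV X = UNIV" and ap_empty [simp]: "ap {} X = {}"
  by (auto simp: ap_def intro: exI[of _ "[]"])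

lemma foldl_ap_UNIV [simp]: "foldl ap UNIV xs = UNIV"
  and foldl_ap_empty [simp]: "foldl ap {} xs = {}"
  by (induction xs) simp_all

lemma ap_test [simp]:
  assumes X: "filt X"
  shows "ap test X = (if Star \<in> X then UNIV else {})"
proof -
  have "Arrow a p \<in> test \<longleftrightarrow> Star \<in> up a" for a p
    by (simp add: test_def)
  moreover have "Star \<in> X" if "Star \<in> up a" "set a \<subseteq> X" for a
    using up_least[OF X that(2)] that(1) by blast
  moreover have "Star \<in> up [Star]" by (simp add: up_def)
  ultimately have "p \<in> ap test X \<longleftrightarrow> Star \<in> X" for p
    unfolding ap_def by (auto intro: exI[of _ "[Star]"])
  then show ?thesis by auto
qed

lemma Star_notin_test [simp]: "Star \<notin> test"
  by (simp add: test_def)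

lemma filt_test [simp]: "filt test"
  unfolding test_def by (rule filt_abst) auto

text \<open>The innermost head of \<open>nest n\<close> is the leaf with index \<open>n\<close>. As \<open>test\<close> is strict and ignores
  the further arguments, that leaf decides the value of the tree.\<close>

lemma Star_in_nest_iff:
  assumes "length xs = 2 * n + 1" "list_all filt xs" "n \<le> m"
    "\<And>k. k \<le> n \<Longrightarrow> xs ! k = (if k < m then test else UNIV)"
  shows "Star \<in> nest n xs \<longleftrightarrow> n = m"
  using assms
proof (induction n arbitrary: m xs)
  case 0
  then show ?case by (cases xs; cases m) auto
next
  case (Suc n)
  from Suc.prems(1) have "length xs = Suc (Suc (2 * n + 1))" by simp
  then obtain x zs y where xs: "xs = x # zs @ [y]" "length zs = 2 * n + 1"
    by (rule length_ge_2E)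
  obtain m' where m: "m = Suc m'" using Suc.prems(3) by (cases m) auto
  have "zs ! k = (if k < m' then test else UNIV)" if "k \<le> n" for k
    using Suc.prems(4)[of "Suc k"] that m xs by (simp add: nth_append)
  then have "Star \<in> nest n zs \<longleftrightarrow> n = m'"
    using Suc.prems m xs by (intro Suc.IH) auto
  moreover have "x = test" using Suc.prems(4)[of 0] m xs by simp
  ultimately show ?case using Suc.prems(2) m xs by (simp add: filt_nest)
qed

text \<open>\<open>test\<close> applied to the first tree gives \<open>UNIV\<close> or
  \<open>{}\<close>, and both absorb all further arguments.\<close>

lemma acts_as_test:
  assumes d: "acts_as d i j" and L: "list_all filt L" "length L \<ge> 2 * i + 2 * j + 3"
  shows "Star \<in> foldl ap d (test # L) \<longleftrightarrow> Star \<in> nest i (take (2 * i + 1) L)"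
proof -
  define xs where "xs = take (2 * i + 1) L"
  define z where "z = L ! (2 * i + 1)"
  define ys where "ys = take (2 * j + 1) (drop (2 * i + 2) L)"
  define us where "us = drop (2 * j + 1) (drop (2 * i + 2) L)"
  have "L = take (2 * i + 1) L @ L ! (2 * i + 1) # drop (Suc (2 * i + 1)) L"
    using L(2) by (intro id_take_nth_drop) simp
  then have "L = xs @ z # ys @ us"
    unfolding xs_def z_def ys_def us_def append_take_drop_id by simp
  moreover have len: "length xs = 2 * i + 1" "length ys = 2 * j + 1"
    using L(2) by (simp_all add: xs_def ys_def)
  moreover from calculation have filt: "list_all filt xs" "filt z" "list_all filt ys"
    using L(1) by simp_all
  ultimately have "foldl ap d (test # L)
      = foldl ap (ap (ap (ap test (nest i xs)) z) (nest j ys)) us"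
    using acts_asD[OF d filt_test, of z xs ys] by simp
  then show ?thesis using filt_nest[OF filt(1) len(1)] by (simp add: xs_def)
qed

lemma acts_as_unique_le:
  assumes "acts_as d i j" "acts_as d i' j'" "i \<le> i'"
  shows "i = i'"
proof -
  \<comment> \<open>\<open>UNIV\<close> sits at index \<open>i'\<close>, the innermost head of
    \<open>nest i'\<close>; a smaller tree has \<open>test\<close> as its innermost head. The tail
    is long enough for both actions.\<close>
  define L where "L = replicate i' test @ UNIV # replicate (2 * i' + 2 * j + 2 * j' + 3) test"
  have L: "list_all filt L" by (simp add: L_def list_all_iff)
  have nth: "L ! k = (if k < i' then test else UNIV)" if "k \<le> i'" for k
    using that by (auto simp: L_def nth_append)
  have "Star \<in> nest i (take (2 * i + 1) L) \<longleftrightarrow> Star \<in> nest i' (take (2 * i' + 1) L)"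
    using acts_as_test[OF assms(1) L] acts_as_test[OF assms(2) L] assms(3)
    by (simp add: L_def)
  moreover have "Star \<in> nest k (take (2 * k + 1) L) \<longleftrightarrow> k = i'" if "k \<le> i'" for k
  proof (rule Star_in_nest_iff[OF _ _ that])
    show "length (take (2 * k + 1) L) = 2 * k + 1" using that by (simp add: L_def)
    show "list_all filt (take (2 * k + 1) L)"
      using L by (auto simp: list_all_iff dest: in_set_takeD)
  qed (use that nth in simp)
  ultimately show ?thesis using assms(3) by blast
qed

lemma acts_as_unique:
  assumes "acts_as d i j" "acts_as d i' j'"
  shows "i = i'"
  using acts_as_unique_le[OF assms] acts_as_unique_le[OF assms(2,1)] by linarith

text \<open>If the parameters \<open>i\<close> of two terms of the orbit agree, then after \<open>i + 1\<close> further steps the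
  parameters \<open>j\<close> of the two terms appear in place of \<open>i\<close>.\<close>

lemma den_self_app_inj:
  assumes "p \<ge> 1" "q \<ge> 1" and eq: "den (self_app B2 p) = den (self_app B2 q)"
  shows "p = q"
proof -
  have eq': "den (self_app B2 (p + n)) = den (self_app B2 (q + n))" for n
    using eq assms(1,2) by (induction n) (simp_all add: self_app_Suc)
  obtain j i j' i' where p: "p = prod_encode (j, i)" and q: "q = prod_encode (j', i')"
    by (metis prod_decode_inverse surj_pair)
  have i: "i' = i"
    using acts_as_self_app[OF assms(1) p] acts_as_self_app[OF assms(2) q] eq
    by (metis acts_as_unique)
  \<comment> \<open>From the pair (i, j), i steps reach the end (0, i + j) of the antidiagonal, and
    one more turns to (i + j + 1, 0).\<close>
  have "prod_encode (j, i) + Suc i = prod_encode (0, Suc (j + i))" for j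
    by (simp add: prod_encode_def)
  then have "acts_as (den (self_app B2 (p + Suc i))) (Suc (j + i)) 0"
    "acts_as (den (self_app B2 (q + Suc i))) (Suc (j' + i)) 0"
    using p q i by (simp_all add: acts_as_self_app prod_encode_def)
  then have "Suc (j + i) = Suc (j' + i)" unfolding eq' by (rule acts_as_unique)
  then have "j = j'" by simp
  then show ?thesis using p q i by simp
qed

theorem theorem3p6:
  shows "\<not> rho_property (B_comb \<circ>\<^sub>B B_comb)"
proof
  assume "rho_property B2"
  then obtain i j where "0 < i" "0 < j" "i \<noteq> j" "self_app B2 i =\<^sub>\<beta>\<^sub>\<eta> self_app B2 j"
    by (auto simp: rho_property_def)
  then show False
    using den_self_app_inj[of i j] eval_beta_eta_equiv[of _ _ "\<lambda>_. {}"] by simp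
qed

end
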